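(* Let $\mathbf{M}_{\mathit{IR}}=\langle S,A_{\mathit{IR}},\Omega,T_{\mathit{IR}},O_{\mathit{IR}},R_{\mathit{IR}},b_0,h\rangle$ be a POMDP-IR and let $\pi_{\mathit{IR}}=\langle\mathbf a_n,a_p\rangle$ be a policy for $\mathbf M_{\mathit{IR}}$ such that at every belief $b$ its prediction action satisfies $a_p\in\operatorname{argmax}_{a_p'}\sum_s b(s)R_{\mathit{IR}}(s,a_p')$. Let $\mathbf M_\rho$ be the $\rho$POMDP obtained from $\mathbf M_{\mathit{IR}}$ by the reduction REDUCE-POMDP-IR-$\rho$, and let $\pi_\rho$ be the policy obtained from $\pi_{\mathit{IR}}$ by the reduction REDUCE-POLICY-IR-$\rho$. Then, for all beliefs $b$ and all $t\ge0$, $$V_t^{\rho}(b)=V_t^{\mathit{IR}}(b),$$ where $V_t^{\mathit{IR}}$ is the $t$-step value of following $\pi_{\mathit{IR}}$ in $\mathbf M_{\mathit{IR}}$ and $V_t^{\rho}$ is the $t$-step value of following $\pi_\rho$ in $\mathbf M_\rho$.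
   Context: All sets are finite. A belief is a probability distribution $b$ on the state set $S$. With transition function $T(s,\mathbf a,s')=\Pr(s'|s,\mathbf a)$ and observation function $O(s',\mathbf a,\mathbf z)=\Pr(\mathbf z|s',\mathbf a)$, put $\Pr(\mathbf z|b,\mathbf a)=\sum_{s}\sum_{s'}O(s',\mathbf a,\mathbf z)T(s,\mathbf a,s')b(s)$, and let $b^{\mathbf a,\mathbf z}(s')=\frac{O(s',\mathbf a,\mathbf z)}{\Pr(\mathbf z|b,\mathbf a)}\sum_s b(s)T(s,\mathbf a,s')$ be the Bayes-updated belief (terms with $\Pr(\mathbf z|b,\mathbf a)=0$ are omitted from sums). A policy maps each belief to an action. $\rho$POMDP: a tuple $\langle S,A_\rho,\Omega,T_\rho,O_\rho,\Gamma_\rho,b_0,h\rangle$ with states $S$, actions $A_\rho$, observations $\Omega$, transition and observation functions $T_\rho,O_\rho$, a nonempty finite set $\Gamma_\rho$ of vectors $\alpha:S\to\mathbb R$, initial belief $b_0$ and horizon $h$. Its immediate reward is $\rho(b)=\max_{\alpha\in\Gamma_\rho}\sum_s b(s)\alpha(s)$. The value function of a policy $\pi_\rho$ is given by $V^\rho_0(b)=\rho(b)$ and, for $t\ge1$, $V^\rho_t(b)=\rho(b)+\sum_{\mathbf z\in\Omega}\Pr(\mathbf z|b,\pi_\rho(b))\,V^\rho_{t-1}(b^{\pi_\rho(b),\mathbf z})$. POMDP-IR: a POMDP whose actions are pairs $\langle \mathbf a_n,a_p\rangle\in A_{n,\mathit{IR}}\times A_{p,\mathit{IR}}$ (normal action,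 prediction action; both sets nonempty), where transitions and observations depend only on $\mathbf a_n$ and the reward $R_{\mathit{IR}}(s,a_p)$ depends only on the state and $a_p$. For a policy $\pi_{\mathit{IR}}(b)=\langle\pi^n_{\mathit{IR}}(b),\pi^p_{\mathit{IR}}(b)\rangle$, the value function is given by $V^{\mathit{IR}}_0(b)=\sum_s b(s)R_{\mathit{IR}}(s,\pi^p_{\mathit{IR}}(b))$ and, for $t\ge1$, $V^{\mathit{IR}}_t(b)=\sum_s b(s)R_{\mathit{IR}}(s,\pi^p_{\mathit{IR}}(b))+\sum_{\mathbf z\in\Omega}\Pr(\mathbf z|b,\pi^n_{\mathit{IR}}(b))\,V^{\mathit{IR}}_{t-1}(b^{\pi^n_{\mathit{IR}}(b),\mathbf z})$. REDUCE-POMDP-IR-$\rho$$(\mathbf M_{\mathit{IR}})$ produces the $\rho$POMDP $\mathbf M_\rho$ with: the same $S$, $\Omega$, $b_0$, $h$; actions $A_\rho=A_{n,\mathit{IR}}$; $T_\rho(s,\mathbf a,s')=T_{\mathit{IR}}(s,\mathbf a_n,s')$ and $O_\rho(s',\mathbf a,\mathbf z)=O_{\mathit{IR}}(s',\mathbf a_n,\mathbf z)$, where $\mathbf a_n\in A_{n,\mathit{IR}}$ corresponds to $\mathbf a\in A_\rho$; and $\Gamma_\rho=\{\alpha^{a_p}_\rho: a_p\in A_{p,\mathit{IR}}\}$ with $\alpha^{a_p}_\rho(s)=R_{\mathit{IR}}(s,a_p)$. REDUCE-POLICY-IR-$\rho$$(\pi_{\mathit{IR}})$ produces $\pi_\rho(b)=\pi^n_{\mathit{IR}}(b)$.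 *)

theory Defs
  imports "HOL-Probability.Probability"
begin

text \<open>
  The finite sets of states, actions and observations are rendered as types of class
  \<open>finite\<close>. Beliefs, and the conditional distributions given by the transition and
  observation functions, are probability mass functions.
\<close>

text \<open>
  The components \<open>T\<close>, \<open>O\<close>, \<open>b\<^sub>0\<close>, \<open>h\<close> shared by both models:
  \<open>pmf (transition M s a) s'\<close> is \<open>Pr(s' | s, a)\<close> and
  \<open>pmf (observation M s' a) z\<close> is \<open>Pr(z | s', a)\<close>.
\<close>

record ('s, 'a, 'z) pomdp_dynamics =
  transition :: "'s \<Rightarrow> 'a \<Rightarrow> 's pmf"
  observation :: "'s \<Rightarrow> 'a \<Rightarrow> 'z pmf"
  init_belief :: "'s pmf"
  horizon :: nat

record ('s, 'a, 'z) rho_pomdp = "('s, 'a, 'z) pomdp_dynamics" +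
  alpha_vectors :: "('s \<Rightarrow> real) set"

definition valid_rho_pomdp :: "('s, 'a, 'z) rho_pomdp \<Rightarrow> bool" where
  "valid_rho_pomdp M \<longleftrightarrow> finite (alpha_vectors M) \<and> alpha_vectors M \<noteq> {}"

text \<open>
  The actions of a POMDP-IR are the pairs in \<open>'n \<times> 'p\<close>. That transitions and observations
  depend only on the normal action, and the reward only on the state and the prediction
  action, is expressed by the argument types of the components.
\<close>

record ('s, 'n, 'p, 'z) pomdp_ir = "('s, 'n, 'z) pomdp_dynamics" +
  reward :: "'s \<Rightarrow> 'p \<Rightarrow> real"

type_synonym ('s, 'a) policy = "'s pmf \<Rightarrow> 'a"

definition expected :: "'s::finite pmf \<Rightarrow> ('s \<Rightarrow> real) \<Rightarrow> real" where
  "expected b f = (\<Sum>s\<in>UNIV. pmf b s * f s)"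

definition obs_prob ::
    "('s::finite, 'a, 'z, 'more) pomdp_dynamics_scheme \<Rightarrow> 's pmf \<Rightarrow> 'a \<Rightarrow> 'z \<Rightarrow> real" where
  "obs_prob M b a z =
    (\<Sum>s\<in>UNIV. \<Sum>s'\<in>UNIV. pmf (observation M s' a) z * pmf (transition M s a) s' * pmf b s)"

text \<open>Meaningful only if \<open>obs_prob M b a z \<noteq> 0\<close>; see \<open>pmf_belief_update\<close> below.\<close>

definition belief_update ::
    "('s::finite, 'a, 'z, 'more) pomdp_dynamics_scheme \<Rightarrow> 's pmf \<Rightarrow> 'a \<Rightarrow> 'z \<Rightarrow> 's pmf" where
  "belief_update M b a z = embed_pmf (\<lambda>s'.
    pmf (observation M s' a) z / obs_prob M b a z * (\<Sum>s\<in>UNIV. pmf b s * pmf (transition M s a) s'))"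

lemma obs_prob_nonneg: "obs_prob M b a z \<ge> 0"
  unfolding obs_prob_def by (intro sum_nonneg mult_nonneg_nonneg pmf_nonneg)

lemma pmf_belief_update:
  assumes "obs_prob M b a z \<noteq> 0"
  shows "pmf (belief_update M b a z) s' =
    pmf (observation M s' a) z / obs_prob M b a z * (\<Sum>s\<in>UNIV. pmf b s * pmf (transition M s a) s')"
proof -
  define f where "f = (\<lambda>s'.
    pmf (observation M s' a) z / obs_prob M b a z * (\<Sum>s\<in>UNIV. pmf b s * pmf (transition M s a) s'))"
  have nonneg: "f x \<ge> 0" for x
    unfolding f_def
    by (intro mult_nonneg_nonneg divide_nonneg_nonneg sum_nonneg pmf_nonneg obs_prob_nonneg)
  have pr: "obs_prob M b a z =
      (\<Sum>s'\<in>UNIV. pmf (observation M s' a) z * (\<Sum>s\<in>UNIV. pmf b s * pmf (transition M s a) s'))"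
    unfolding obs_prob_def
    by (subst sum.swap) (simp add: sum_distrib_left mult_ac)
  have "(\<Sum>x\<in>UNIV. f x) = obs_prob M b a z / obs_prob M b a z"
    unfolding f_def times_divide_eq_left sum_divide_distrib[symmetric] pr[symmetric] ..
  then have "(\<Sum>x\<in>UNIV. f x) = 1"
    using assms by simp
  then have "(\<integral>\<^sup>+ x. ennreal (f x) \<partial>count_space UNIV) = 1"
    using nonneg by (simp add: nn_integral_count_space_finite sum_ennreal)
  then have "pmf (embed_pmf f) s' = f s'"
    using nonneg by (intro pmf_embed_pmf) auto
  then show ?thesis
    unfolding belief_update_def f_def .
qed

definition rho :: "('s::finite, 'a, 'z) rho_pomdp \<Rightarrow> 's pmf \<Rightarrow> real" where
  "rho M b = Max ((\<lambda>\<alpha>. expected b \<alpha>) ` alpha_vectors M)"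

primrec value_rho ::
    "('s::finite, 'a, 'z::finite) rho_pomdp \<Rightarrow> ('s, 'a) policy \<Rightarrow> nat \<Rightarrow> 's pmf \<Rightarrow> real" where
  "value_rho M \<pi> 0 b = rho M b"
| "value_rho M \<pi> (Suc t) b = rho M b +
    (\<Sum>z | obs_prob M b (\<pi> b) z \<noteq> 0.
      obs_prob M b (\<pi> b) z * value_rho M \<pi> t (belief_update M b (\<pi> b) z))"

primrec value_ir ::
    "('s::finite, 'n, 'p, 'z::finite) pomdp_ir \<Rightarrow> ('s, 'n \<times> 'p) policy \<Rightarrow> nat \<Rightarrow> 's pmf \<Rightarrow> real"
where
  "value_ir M \<pi> 0 b = expected b (\<lambda>s. reward M s (snd (\<pi> b)))"
| "value_ir M \<pi> (Suc t) b = expected b (\<lambda>s. reward M s (snd (\<pi> b))) +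
    (\<Sum>z | obs_prob M b (fst (\<pi> b)) z \<noteq> 0.
      obs_prob M b (fst (\<pi> b)) z * value_ir M \<pi> t (belief_update M b (fst (\<pi> b)) z))"

definition reduce_pomdp_ir_rho ::
    "('s, 'n, 'p::finite, 'z) pomdp_ir \<Rightarrow> ('s, 'n, 'z) rho_pomdp" where
  "reduce_pomdp_ir_rho M =
    \<lparr>transition = transition M, observation = observation M,
     init_belief = init_belief M, horizon = horizon M,
     alpha_vectors = range (\<lambda>p s. reward M s p)\<rparr>"

lemma valid_reduce_pomdp_ir_rho: "valid_rho_pomdp (reduce_pomdp_ir_rho M)"
  by (simp add: valid_rho_pomdp_def reduce_pomdp_ir_rho_def)

definition reduce_policy_ir_rho :: "('s, 'n \<times> 'p) policy \<Rightarrow> ('s, 'n) policy" where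
  "reduce_policy_ir_rho \<pi> = (\<lambda>b. fst (\<pi> b))"

end

theory Submission
  imports Defs
begin

text \<open>The reduction keeps the dynamics, so both value recursions weigh the same updated
  beliefs by the same probabilities and can differ only in the immediate reward. There
  \<open>rho\<close> maximises over one vector per prediction action, and a greedy prediction
  attains that maximum (\<open>rho_reduce_pomdp_ir_rho\<close>). Induction on the number of steps
  then gives equality.\<close>

lemma obs_prob_reduce_pomdp_ir_rho:
  "obs_prob (reduce_pomdp_ir_rho M) b a z = obs_prob M b a z"
  by (simp add: obs_prob_def reduce_pomdp_ir_rho_def)

text \<open>The arguments of \<open>embed_pmf\<close> coincide, so no condition
  \<open>obs_prob M b a z \<noteq> 0\<close> is called for.\<close>

lemma belief_update_reduce_pomdp_ir_rho:
  "belief_update (reduce_pomdp_ir_rho M) b a z = belief_update M b a z"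
  unfolding belief_update_def obs_prob_reduce_pomdp_ir_rho
  by (simp add: reduce_pomdp_ir_rho_def)

text \<open>The expected reward of an argmax \<open>p\<close> both belongs to the finite set under
  \<open>Max\<close> and bounds it from above.\<close>

lemma rho_reduce_pomdp_ir_rho:
  assumes "is_arg_max (\<lambda>p. expected b (\<lambda>s. reward M s p)) (\<lambda>_. True) p"
  shows "rho (reduce_pomdp_ir_rho M) b = expected b (\<lambda>s. reward M s p)"
proof -
  have "expected b (\<lambda>s. reward M s q) \<le> expected b (\<lambda>s. reward M s p)" for q
    using assms by (auto simp: is_arg_max_linorder)
  then show ?thesis
    by (auto simp: rho_def reduce_pomdp_ir_rho_def intro!: Max_eqI)
qed

theorem theorem2:
  fixes M :: "('s::finite, 'n::finite, 'p::finite, 'z::finite) pomdp_ir"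
    and \<pi> :: "('s, 'n \<times> 'p) policy"
  assumes "\<And>b. is_arg_max (\<lambda>p. expected b (\<lambda>s. reward M s p)) (\<lambda>_. True) (snd (\<pi> b))"
  shows "\<forall>b t. value_rho (reduce_pomdp_ir_rho M) (reduce_policy_ir_rho \<pi>) t b = value_ir M \<pi> t b"
proof (intro allI)
  fix b t
  show "value_rho (reduce_pomdp_ir_rho M) (reduce_policy_ir_rho \<pi>) t b = value_ir M \<pi> t b"
    \<comment> \<open>The belief is generalised because the recursion moves to updated beliefs;
      greediness is assumed at every belief, so it covers those too.\<close>
    by (induction t arbitrary: b)
      (simp_all add: rho_reduce_pomdp_ir_rho[OF assms] obs_prob_reduce_pomdp_ir_rho
        belief_update_reduce_pomdp_ir_rho reduce_policy_ir_rho_def)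
qed

end
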